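(* Let $\eta^0\in\{0,1\}^{\mathbb{N}}$ be a semi-infinite binary sequence with finitely many $1$s, and for $t\ge 0$ let $\eta^{t+1}$ be the image of $\eta^t$ under the time evolution of the BBS-S(2), i.e. the output sequence of the automaton MA-$[3,2,154,7]$ started in state $q_0$ on input $\eta^t$. Let $\overline{b}^t=(b_1^t,b_2^t,\ldots)$ and $\overline{c}^t=(c_1^t,c_2^t,\ldots)$ be the two finite integer sequences associated with $\eta^t$. Then for all $t\in\mathbb{Z}_{\ge0}$ the sequences $\overline{b}^t$ and $\overline{b}^0$ have the same length, the sequences $\overline{c}^t$ and $\overline{c}^0$ have the same length, and for all indices $j$ $$b_j^t=b_j^0+t,\qquad c_j^t=c_j^0+2t.$$
   Context: The automaton MA-$[3,2,154,7]$ has states $q_0,q_1,q_2$ and alphabet $\{0,1\}$. Its transition function $\varphi$ and exit function $\psi$ are $\varphi(q_0,0)=q_0,\ \varphi(q_0,1)=q_1,\ \varphi(q_1,0)=q_2,\ \varphi(q_1,1)=q_2,\ \varphi(q_2,0)=q_0,\ \varphi(q_2,1)=q_1$; $\psi(q_0,0)=0,\ \psi(q_0,1)=0,\ \psi(q_1,0)=0,\ \psi(q_1,1)=1,\ \psi(q_2,0)=1,\ \psi(q_2,1)=1$. On an input sequence $s_1s_2s_3\cdots$ with initial state $q_0$, the output is $\tilde s_1\tilde s_2\tilde s_3\cdots$ where $p_1=q_0$, $p_{j+1}=\varphi(p_j,s_j)$, $\tilde s_j=\psi(p_j,s_j)$. Associated integer sequences: given a semi-infinite binary sequence with finitely many $1$s,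 replace each maximal run of consecutive $1$s by letters $\mathrm{b},\mathrm{c}$: a run $1^{2k}$ of even length becomes $\mathrm{b}^k$, and a run $1^{2k+1}$ of odd length becomes $\mathrm{b}^k\mathrm{c}$; the $0$s are kept. In the resulting sequence over $\{0,\mathrm{b},\mathrm{c}\}$, $b_j$ is the number of $0$s to the left of the $j$-th letter $\mathrm{b}$ from the left, and $c_j$ is the number of $0$s to the left of the $j$-th letter $\mathrm{c}$ from the left. Then $\overline{b}=(b_1,b_2,\ldots)$ and $\overline{c}=(c_1,c_2,\ldots)$. *)

theory Defs
  imports Main
begin

text \<open>
  A semi-infinite binary sequence $s_1 s_2 s_3 \cdots$ is a function \<open>s :: nat \<Rightarrow> bool\<close>
  with \<open>True\<close> for 1 and \<open>False\<close> for 0; indices are shifted, so \<open>s j\<close> is $s_{j+1}$.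
\<close>

datatype state = Q0 | Q1 | Q2

fun \<phi> :: "state \<Rightarrow> bool \<Rightarrow> state" where
  "\<phi> Q0 False = Q0"
| "\<phi> Q0 True  = Q1"
| "\<phi> Q1 False = Q2"
| "\<phi> Q1 True  = Q2"
| "\<phi> Q2 False = Q0"
| "\<phi> Q2 True  = Q1"

fun \<psi> :: "state \<Rightarrow> bool \<Rightarrow> bool" where
  "\<psi> Q0 False = False"
| "\<psi> Q0 True  = False"
| "\<psi> Q1 False = False"
| "\<psi> Q1 True  = True"
| "\<psi> Q2 False = True"
| "\<psi> Q2 True  = True"

primrec state_at :: "(nat \<Rightarrow> bool) \<Rightarrow> nat \<Rightarrow> state" where
  "state_at s 0 = Q0"
| "state_at s (Suc j) = \<phi> (state_at s j) (s j)"

definition automaton_output :: "(nat \<Rightarrow> bool) \<Rightarrow> nat \<Rightarrow> bool" where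
  "automaton_output s j = \<psi> (state_at s j) (s j)"

datatype letter = Zero | B | C

definition run_letters :: "nat \<Rightarrow> letter list" where
  "run_letters n = replicate (n div 2) B @ (if odd n then [C] else [])"

text \<open>
  A leading \<open>True\<close> always starts a maximal run: recursive calls are made either
  after a 0 or on the remainder \<open>dropWhile id xs\<close>, which is empty or starts with a 0.
\<close>

function replace_runs :: "bool list \<Rightarrow> letter list" where
  "replace_runs [] = []"
| "replace_runs (False # xs) = Zero # replace_runs xs"
| "replace_runs (True # xs) =
     run_letters (Suc (length (takeWhile id xs))) @ replace_runs (dropWhile id xs)"
  by pat_completeness auto
termination
  by (relation "measure length") (auto simp: less_Suc_eq_le length_dropWhile_le)

definition support_length :: "(nat \<Rightarrow> bool) \<Rightarrow> nat" where
  "support_length s = (LEAST N. \<forall>i\<ge>N. \<not> s i)"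

text \<open>
  For a sequence with finitely many 1s, all runs lie in the prefix of length
  \<open>support_length s\<close>; the remaining 0s are kept, so the word continues with \<open>Zero\<close>s.
\<close>

definition letter_word :: "(nat \<Rightarrow> bool) \<Rightarrow> nat \<Rightarrow> letter" where
  "letter_word s n =
     (let w = replace_runs (map s [0..<support_length s])
      in if n < length w then w ! n else Zero)"

text \<open>
  The entry at (0-based) index \<open>j\<close> is the number of 0s to the left of the
  occurrence number \<open>j + 1\<close> of the letter \<open>l\<close>. Meaningful only if \<open>l\<close> occurs finitely often
  (\<open>sorted_list_of_set\<close> of an infinite set is empty), as \<open>B\<close> and \<open>C\<close> do in a \<open>letter_word\<close>.
\<close>

definition zeros_before :: "letter \<Rightarrow> (nat \<Rightarrow> letter) \<Rightarrow> nat list" where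
  "zeros_before l w =
     map (\<lambda>p. card {i. i < p \<and> w i = Zero}) (sorted_list_of_set {p. w p = l})"

definition b_seq :: "(nat \<Rightarrow> bool) \<Rightarrow> nat list" where
  "b_seq s = zeros_before B (letter_word s)"

definition c_seq :: "(nat \<Rightarrow> bool) \<Rightarrow> nat list" where
  "c_seq s = zeros_before C (letter_word s)"

end

(*
  Both the input and the output of the automaton can be decoded online, from left to
  right: 11 is a B, and 10 is a C followed by a 0. Run the two decoders in parallel.
  At any moment the output decoder has read at most one 0 more than the input decoder,
  and it owes at most one letter that the input has already completed: a B one 0 further
  to the right, or a C two 0s further to the right. These finitely many situations form
  an invariant of the computation, and trailing 0s clear the debt.
*)
theory Submission
  imports Defs
begin

section \<open>Online decoding of runs of 1s\<close>

lemma run_letters_Suc_Suc: "run_letters (Suc (Suc n)) = B # run_letters n"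
  by (simp add: run_letters_def)

text \<open>A leading run of length 0 contributes no letters, so the run equation of
  \<open>replace_runs\<close> extends to every list. This is what allows a pair 11 to be split off a
  longer run.\<close>

lemma replace_runs_takeWhile_dropWhile:
  "run_letters (length (takeWhile id xs)) @ replace_runs (dropWhile id xs) = replace_runs xs"
proof (cases xs)
  case (Cons x ys)
  then show ?thesis by (cases x) (simp_all add: run_letters_def)
qed (simp add: run_letters_def)

text \<open>Together with the next two rules this turns \<open>replace_runs\<close> into a
  left-to-right decoder with one symbol of lookahead; these rules then replace the
  \<open>takeWhile\<close> equation in the simpset.\<close>

lemma replace_runs_True_True [simp]: "replace_runs (True # True # xs) = B # replace_runs xs"
  using replace_runs_takeWhile_dropWhile[of xs] by (simp add: run_letters_Suc_Suc)

lemma replace_runs_True_False [simp]: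
  "replace_runs (True # False # xs) = C # Zero # replace_runs xs"
  by (simp add: run_letters_def)

lemma replace_runs_single_True [simp]: "replace_runs [True] = [C]"
  by (simp add: run_letters_def)

declare replace_runs.simps(3) [simp del]

text \<open>The end of the list closes a run just as a 0 does: a final unpaired 1 is a C in both
  cases. The induction is on length because the decoder consumes one or two symbols at a
  time.\<close>

lemma replace_runs_append_replicate_False:
  "replace_runs (xs @ replicate k False) = replace_runs xs @ replicate k Zero"
proof (induction xs rule: length_induct)
  case (1 xs)
  have zeros: "replace_runs (replicate m False) = replicate m Zero" for m
    by (induction m) simp_all
  have one: "replace_runs (True # replicate m False) = C # replicate m Zero" for m
    by (cases m) (simp_all add: zeros)
  consider "xs = []" | ys where "xs = False # ys" | "xs = [True]"
    | ys where "xs = True # True # ys" | ys where "xs = True # False # ys"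
    by (metis (full_types) neq_Nil_conv)
  then show ?case
    using 1 by cases (simp_all add: zeros one)
qed

section \<open>Counting zeros recursively along a word\<close>

fun zeros_before_list :: "letter \<Rightarrow> nat \<Rightarrow> letter list \<Rightarrow> nat list" where
  "zeros_before_list l n [] = []"
| "zeros_before_list l n (a # w) =
     (if a = l then [n] else []) @ zeros_before_list l (if a = Zero then Suc n else n) w"

text \<open>Detached from \<open>support_length\<close>, the word can vary freely in an
  induction.\<close>

definition zero_extension :: "letter list \<Rightarrow> nat \<Rightarrow> letter" where
  "zero_extension w n = (if n < length w then w ! n else Zero)"

lemma letter_word_eq:
  "letter_word s = zero_extension (replace_runs (map s [0..<support_length s]))"
  by (simp add: fun_eq_iff letter_word_def zero_extension_def Let_def)

lemma zero_extension_Nil [simp]: "zero_extension [] n = Zero"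
  by (simp add: zero_extension_def)

lemma zero_extension_Cons_0 [simp]: "zero_extension (a # w) 0 = a"
  by (simp add: zero_extension_def)

lemma zero_extension_Cons_Suc [simp]: "zero_extension (a # w) (Suc n) = zero_extension w n"
  by (simp add: zero_extension_def)

lemma finite_zero_extension_positions:
  assumes "l \<noteq> Zero"
  shows "finite {p. zero_extension w p = l}"
  by (rule finite_subset[of _ "{..<length w}"])
    (use assms in \<open>auto simp: zero_extension_def split: if_splits\<close>)

lemma Collect_nat_split: "{p. P p} = (if P 0 then {0} else {}) \<union> Suc ` {p. P (Suc p)}"
proof -
  have "p \<in> {p. P p} \<longleftrightarrow> p \<in> (if P 0 then {0} else {}) \<union> Suc ` {p. P (Suc p)}" for p
    by (cases p) auto
  then show ?thesis by blast
qed

lemma sorted_list_of_set_Suc_image: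
  "sorted_list_of_set (Suc ` A) = map Suc (sorted_list_of_set A)"
proof (cases "finite A")
  case True
  have "sorted (map Suc (sorted_list_of_set A))"
    by (simp add: sorted_map)
  moreover have "distinct (map Suc (sorted_list_of_set A))"
    by (simp add: distinct_map)
  moreover have "set (map Suc (sorted_list_of_set A)) = Suc ` A"
    using True by simp
  ultimately show ?thesis
    by (metis sorted_list_of_set.idem_if_sorted_distinct)
next
  case False
  then show ?thesis by (simp add: finite_image_iff)
qed

lemma sorted_list_of_set_Collect_nat_split:
  assumes "finite {p. P p}"
  shows "sorted_list_of_set {p. P p} =
    (if P 0 then [0] else []) @ map Suc (sorted_list_of_set {p. P (Suc p)})"
proof -
  have fin: "finite (Suc ` {p. P (Suc p)})"
    using assms by (subst (asm) Collect_nat_split) auto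
  have "sorted_list_of_set (insert 0 (Suc ` {p. P (Suc p)})) =
      0 # sorted_list_of_set (Suc ` {p. P (Suc p)})"
    using fin by (subst sorted_list_of_set_insert) (auto simp: insort_is_Cons)
  then show ?thesis
    by (subst Collect_nat_split) (simp add: sorted_list_of_set_Suc_image)
qed

lemma card_Zero_before_Suc:
  "card {i. i < Suc p \<and> zero_extension (a # w) i = Zero} =
     (if a = Zero then 1 else 0) + card {i. i < p \<and> zero_extension w i = Zero}"
proof -
  have "finite (Suc ` {i. i < p \<and> zero_extension w i = Zero})"
    by simp
  then show ?thesis
    by (subst Collect_nat_split) (auto simp: card_image)
qed

text \<open>Removing the first letter shifts all positions by \<open>Suc\<close>, and a leading
  \<open>Zero\<close> raises all later counts by one; the arbitrary offset \<open>n\<close> absorbs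
  this. For \<open>Zero\<close> itself the set of positions would be infinite.\<close>

lemma zeros_before_list_add:
  assumes "l \<noteq> Zero"
  shows "map ((+) n) (zeros_before l (zero_extension w)) = zeros_before_list l n w"
proof (induction w arbitrary: n)
  case Nil
  then show ?case using assms by (simp add: zeros_before_def)
next
  case (Cons a w)
  have fin: "finite {p. zero_extension (a # w) p = l}"
    using assms by (rule finite_zero_extension_positions)
  have "map ((+) n) (zeros_before l (zero_extension (a # w))) =
      (if a = l then [n] else []) @
      map ((+) (if a = Zero then Suc n else n)) (zeros_before l (zero_extension w))"
    unfolding zeros_before_def sorted_list_of_set_Collect_nat_split[OF fin]
    by (auto simp: card_Zero_before_Suc)
  then show ?case using Cons.IH by simp
qed

lemma zeros_before_zero_extension:
  assumes "l \<noteq> Zero"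
  shows "zeros_before l (zero_extension w) = zeros_before_list l 0 w"
proof -
  have "map ((+) 0) (zeros_before l (zero_extension w)) = zeros_before_list l 0 w"
    by (rule zeros_before_list_add[OF assms])
  then show ?thesis by (simp add: map_idI)
qed

lemma zeros_before_list_append_Zeros:
  assumes "l \<noteq> Zero"
  shows "zeros_before_list l n (w @ replicate k Zero) = zeros_before_list l n w"
proof (induction w arbitrary: n)
  case Nil
  show ?case using assms by (induction k arbitrary: n) auto
qed simp

text \<open>Enlarging the prefix beyond the support only appends \<open>Zero\<close>s. Input and
  output, whose supports differ, can thus be compared on a common prefix.\<close>

lemma zeros_before_letter_word:
  assumes "l \<noteq> Zero" and zero: "\<And>i. i \<ge> N \<Longrightarrow> \<not> s i"
  shows "zeros_before l (letter_word s) =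
    zeros_before_list l 0 (replace_runs (map s [0..<N]))"
proof -
  let ?L = "support_length s"
  have ex: "\<forall>i\<ge>N. \<not> s i" using zero by simp
  have le: "?L \<le> N"
    unfolding support_length_def using ex by (rule Least_le)
  have after: "\<forall>i\<ge>?L. \<not> s i"
    unfolding support_length_def using ex by (rule LeastI)
  have "[0..<N] = [0..<?L] @ [?L..<N]"
    using le by (metis le_add_diff_inverse upt_add_eq_append zero_le)
  moreover have "map s [?L..<N] = replicate (N - ?L) False"
    using after by (intro nth_equalityI) auto
  ultimately have "map s [0..<N] = map s [0..<?L] @ replicate (N - ?L) False"
    by simp
  then show ?thesis
    using assms(1)
    by (simp add: letter_word_eq zeros_before_zero_extension
        replace_runs_append_replicate_False zeros_before_list_append_Zeros)
qed

section \<open>The automaton on finite prefixes\<close>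

fun automaton_run :: "state \<Rightarrow> bool list \<Rightarrow> bool list" where
  "automaton_run q [] = []"
| "automaton_run q (x # xs) = \<psi> q x # automaton_run (\<phi> q x) xs"

lemma map_automaton_output:
  "map (automaton_output s) [m..<m + k] = automaton_run (state_at s m) (map s [m..<m + k])"
proof (induction k arbitrary: m)
  case (Suc k)
  have "[m..<m + Suc k] = m # [Suc m..<Suc m + k]"
    by (simp add: upt_rec)
  then show ?case
    using Suc.IH[of "Suc m"] by (simp add: automaton_output_def)
qed simp

text \<open>The value at \<open>Zero\<close> is irrelevant.\<close>

fun speed :: "letter \<Rightarrow> nat" where
  "speed Zero = 0"
| "speed B = 1"
| "speed C = 2"

text \<open>
  An incomplete letter is represented by a \<open>True\<close> put in front of the unread sequence, on the
  input side (state \<open>Q1\<close>) or on the output side; a list \<open>[n]\<close> or \<open>[Suc n]\<close> on the right is a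
  letter that the input has completed and the output still owes.
\<close>

lemma automaton_run_invariant:
  assumes "l \<noteq> Zero" and "x = ys @ [False, False]"
  shows
    "zeros_before_list l n (replace_runs (automaton_run Q0 x)) =
       map ((+) (speed l)) (zeros_before_list l n (replace_runs x))"
    "zeros_before_list l n (replace_runs (True # automaton_run Q0 x)) =
       (if l = C then [n] else []) @
       map ((+) (speed l)) (zeros_before_list l n (replace_runs x))"
    "zeros_before_list l (Suc n) (replace_runs (automaton_run Q1 x)) =
       map ((+) (speed l)) (zeros_before_list l n (replace_runs (True # x)))"
    "zeros_before_list l (Suc n) (replace_runs (True # automaton_run Q1 x)) =
       (if l = C then [Suc n] else []) @
       map ((+) (speed l)) (zeros_before_list l n (replace_runs (True # x)))"
    "zeros_before_list l (Suc n) (replace_runs (True # automaton_run Q2 x)) =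
       (if l = B then [Suc n] else []) @
       map ((+) (speed l)) (zeros_before_list l n (replace_runs x))"
    "zeros_before_list l (Suc n) (replace_runs (automaton_run Q2 x)) =
       (if l = C then [Suc n] else []) @
       map ((+) (speed l)) (zeros_before_list l n (replace_runs x))"
  using assms(2)
proof (induction ys arbitrary: n x)
  \<comment> \<open>Two final 0s are needed in state \<open>Q1\<close>: the first is output as 0,
    and only the second writes the 1 that becomes the C.\<close>
  case Nil
  {
    case 1 then show ?case using assms(1) by (cases l) simp_all
  next
    case 2 then show ?case using assms(1) by (cases l) simp_all
  next
    case 3 then show ?case using assms(1) by (cases l) simp_all
  next
    case 4 then show ?case using assms(1) by (cases l) simp_all
  next
    case 5 then show ?case using assms(1) by (cases l) simp_all
  next
    case 6 then show ?case using assms(1) by (cases l) simp_all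
  }
next
  case (Cons y ys)
  \<comment> \<open>Reading one symbol turns each of the six situations into one of the six, with
    the offset kept or raised by one, so all are proved jointly. Following a single letter
    \<open>l\<close> hides changes of order: in the fourth situation a 1 lets the output write a B
    before the C that preceded it in the input.\<close>
  note IH = Cons.IH[OF refl]
  {
    case 1 then show ?case using assms(1) IH by (cases y; cases l) simp_all
  next
    case 2 then show ?case using assms(1) IH by (cases y; cases l) simp_all
  next
    case 3 then show ?case using assms(1) IH by (cases y; cases l) simp_all
  next
    case 4 then show ?case using assms(1) IH by (cases y; cases l) simp_all
  next
    case 5 then show ?case using assms(1) IH by (cases y; cases l) simp_all
  next
    case 6 then show ?case using assms(1) IH by (cases y; cases l) simp_all
  }
qed

section \<open>Finite support and one time step\<close>

lemma state_at_after_zeros: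
  assumes "\<And>i. i \<ge> N \<Longrightarrow> \<not> s i"
  shows "state_at s (Suc (Suc N) + k) = Q0"
proof (induction k)
  case 0
  show ?case using assms[of N] assms[of "Suc N"] by (cases "state_at s N") simp_all
next
  case (Suc k)
  then show ?case using assms[of "Suc (Suc N) + k"] by simp
qed

text \<open>The automaton may enter the trailing 0s in \<open>Q1\<close>, from which it needs two of
  them to reach \<open>Q0\<close>; hence the support bound grows by two.\<close>

lemma automaton_output_after_zeros:
  assumes zero: "\<And>i. i \<ge> N \<Longrightarrow> \<not> s i" and le: "i \<ge> Suc (Suc N)"
  shows "\<not> automaton_output s i"
proof -
  have "state_at s i = Q0"
    using state_at_after_zeros[of N s "i - Suc (Suc N)", OF zero] le
    by (simp only: le_add_diff_inverse)
  then show ?thesis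
    using zero[of i] le by (simp add: automaton_output_def)
qed

lemma finite_nat_Collect_bound:
  assumes "finite {i::nat. P i}"
  shows "\<exists>N. \<forall>i\<ge>N. \<not> P i"
proof -
  obtain N where "\<forall>i\<in>{i. P i}. i < N"
    using assms unfolding finite_nat_set_iff_bounded ..
  then have "\<forall>i\<ge>N. \<not> P i" by force
  then show ?thesis by blast
qed

lemma finite_automaton_output:
  assumes "finite {i. s i}"
  shows "finite {i. automaton_output s i}"
proof -
  obtain N where "\<And>i. i \<ge> N \<Longrightarrow> \<not> s i"
    using finite_nat_Collect_bound[OF assms] by blast
  then have "i < Suc (Suc N)" if "automaton_output s i" for i
    using automaton_output_after_zeros[of N s i] that by (cases "i < Suc (Suc N)") simp_all
  then have "{i. automaton_output s i} \<subseteq> {..<Suc (Suc N)}"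
    unfolding subset_iff mem_Collect_eq lessThan_iff by blast
  then show ?thesis
    by (rule finite_subset) simp
qed

lemma zeros_before_automaton_output:
  assumes "l \<noteq> Zero" and "finite {i. s i}"
  shows "zeros_before l (letter_word (automaton_output s)) =
    map ((+) (speed l)) (zeros_before l (letter_word s))"
proof -
  obtain N where zero: "\<And>i. i \<ge> N \<Longrightarrow> \<not> s i"
    using finite_nat_Collect_bound[OF assms(2)] by blast
  \<comment> \<open>The two extra positions both supply the 0s at the end required by the invariant
    and bound the support of the output.\<close>
  let ?M = "Suc (Suc N)"
  have input: "map s [0..<?M] = map s [0..<N] @ [False, False]"
    using zero[of N] zero[of "Suc N"] by simp
  have out: "map (automaton_output s) [0..<?M] = automaton_run Q0 (map s [0..<?M])"
    using map_automaton_output[of s 0 ?M] by simp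
  have "zeros_before l (letter_word (automaton_output s)) =
      zeros_before_list l 0 (replace_runs (automaton_run Q0 (map s [0..<?M])))"
    unfolding out[symmetric]
    using automaton_output_after_zeros[OF zero] assms(1) by (intro zeros_before_letter_word)
  also have "\<dots> = map ((+) (speed l)) (zeros_before_list l 0 (replace_runs (map s [0..<?M])))"
    using assms(1) input by (rule automaton_run_invariant(1))
  also have "zeros_before_list l 0 (replace_runs (map s [0..<?M])) = zeros_before l (letter_word s)"
    using assms(1) zero by (intro zeros_before_letter_word[symmetric]) auto
  finally show ?thesis .
qed

theorem mainTheorem3:
  fixes \<eta> :: "nat \<Rightarrow> nat \<Rightarrow> bool"
  assumes "finite {i. \<eta> 0 i}"
    and "\<And>t. \<eta> (Suc t) = automaton_output (\<eta> t)"
  shows "\<forall>t. length (b_seq (\<eta> t)) = length (b_seq (\<eta> 0))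
           \<and> length (c_seq (\<eta> t)) = length (c_seq (\<eta> 0))
           \<and> (\<forall>j < length (b_seq (\<eta> 0)). b_seq (\<eta> t) ! j = b_seq (\<eta> 0) ! j + t)
           \<and> (\<forall>j < length (c_seq (\<eta> 0)). c_seq (\<eta> t) ! j = c_seq (\<eta> 0) ! j + 2 * t)"
proof -
  \<comment> \<open>Finiteness must persist in time for the one-step shift to be iterated.\<close>
  have fin: "finite {i. \<eta> t i}" for t
    by (induction t) (simp_all add: assms finite_automaton_output)
  have shift: "zeros_before l (letter_word (\<eta> t)) =
      map ((+) (t * speed l)) (zeros_before l (letter_word (\<eta> 0)))" if "l \<noteq> Zero" for l t
  proof (induction t)
    case 0
    show ?case by (simp add: map_idI)
  next
    case (Suc t)
    then show ?case
      using zeros_before_automaton_output[OF that fin[of t]]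
      by (simp add: assms(2) add.assoc)
  qed
  show ?thesis
  proof
    fix t
    have "b_seq (\<eta> t) = map ((+) t) (b_seq (\<eta> 0))"
      using shift[of B t] by (simp add: b_seq_def)
    moreover have "c_seq (\<eta> t) = map ((+) (2 * t)) (c_seq (\<eta> 0))"
      using shift[of C t] by (simp add: c_seq_def mult.commute)
    ultimately show "length (b_seq (\<eta> t)) = length (b_seq (\<eta> 0))
           \<and> length (c_seq (\<eta> t)) = length (c_seq (\<eta> 0))
           \<and> (\<forall>j < length (b_seq (\<eta> 0)). b_seq (\<eta> t) ! j = b_seq (\<eta> 0) ! j + t)
           \<and> (\<forall>j < length (c_seq (\<eta> 0)). c_seq (\<eta> t) ! j = c_seq (\<eta> 0) ! j + 2 * t)"
      by simp
  qed
qed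

end
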